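(* Let $(X,T)$ be a topological dynamical system with a metric $d$. Then, for every $\epsilon>0$ (the parameter entering the definitions of the first two quantities), $$\overline{\mathrm{mdim}}_{M}^{*}(T,X,d)=\overline{\mathrm{mdim}}_{pre}(T,X,d)=\overline{\mathrm{mdim}}_{M}(T,X,d).$$
   Context: A topological dynamical system (TDS) $(X,T)$ with metric $d$: $X$ is a compact metrizable space with compatible metric $d$, and $T:X\to X$ is continuous. With $d_n(x,y)=\max_{0\le j\le n-1}d(T^jx,T^jy)$, $B_n(x,\epsilon)=\{y:d_n(x,y)<\epsilon\}$ and $B(x,\epsilon)=\{y:d(x,y)<\epsilon\}$. For $Z\subset X$ let $r_n(T,Z,d,\delta)$ be the smallest cardinality of a set $E\subset X$ such that every $x\in Z$ has some $y\in E$ with $d_n(x,y)<\delta$. For a positive sequence, $GR(p_n)=\limsup_{n\to\infty}\frac{\log p_n}{n}$. Upper metric mean dimension: $\overline{\mathrm{mdim}}_{M}(T,X,d)=\limsup_{\delta\to0}\frac{1}{\log\frac1\delta}\limsup_{n\to\infty}\frac1n\log r_n(T,X,d,\delta)$. Upper tail metric mean dimension and upper preimage neighborhood metric mean dimension, defined for a given $\epsilon>0$: $$\overline{\mathrm{mdim}}_{M}^{*}(T,X,d)=\limsup_{\delta\to0}\frac{1}{\log\frac1\delta}GR\Big(\sup_{x\in X}r_n(T,B_n(x,\epsilon),d,\delta)\Big),$$ $$\overline{\mathrm{mdim}}_{pre}(T,X,d)=\limsup_{\delta\to0}\frac{1}{\log\frac1\delta}GR\Big(\sup_{x\in X,\,k\ge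 n}r_n(T,T^{-k}B(x,\epsilon),d,\delta)\Big).$$ *)

theory Defs
  imports "HOL-Analysis.Analysis"
begin

definition TDS :: "'a set \<Rightarrow> ('a \<Rightarrow> 'a \<Rightarrow> real) \<Rightarrow> ('a \<Rightarrow> 'a) \<Rightarrow> bool" where
  "TDS X d T \<longleftrightarrow>
     Metric_space X d \<and>
     compact_space (Metric_space.mtopology X d) \<and>
     continuous_map (Metric_space.mtopology X d) (Metric_space.mtopology X d) T"

(* Only meaningful for n > 0, since Max {} is unspecified. All growth rates below
   are limits superior as n tends to infinity, so n = 0 is irrelevant. *)
definition bowen_dist ::
  "('a \<Rightarrow> 'a) \<Rightarrow> ('a \<Rightarrow> 'a \<Rightarrow> real) \<Rightarrow> nat \<Rightarrow> 'a \<Rightarrow> 'a \<Rightarrow> real" where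
  "bowen_dist T d n x y = Max ((\<lambda>j. d ((T ^^ j) x) ((T ^^ j) y)) ` {..<n})"

definition bowen_ball ::
  "'a set \<Rightarrow> ('a \<Rightarrow> 'a) \<Rightarrow> ('a \<Rightarrow> 'a \<Rightarrow> real) \<Rightarrow> nat \<Rightarrow> 'a \<Rightarrow> real \<Rightarrow> 'a set" where
  "bowen_ball X T d n x \<epsilon> = {y \<in> X. bowen_dist T d n x y < \<epsilon>}"

(* The ambient space X is an argument because the spanning points are taken in X,
   not in Z. The value is infinity if there is no finite spanning set. *)
definition span_num ::
  "'a set \<Rightarrow> ('a \<Rightarrow> 'a) \<Rightarrow> ('a \<Rightarrow> 'a \<Rightarrow> real) \<Rightarrow> nat \<Rightarrow> 'a set \<Rightarrow> real \<Rightarrow> enat" where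
  "span_num X T d n Z \<delta> =
     (INF E \<in> {E. E \<subseteq> X \<and> finite E \<and> (\<forall>x\<in>Z. \<exists>y\<in>E. bowen_dist T d n x y < \<delta>)}. enat (card E))"

definition ln_enat :: "enat \<Rightarrow> ereal" where
  "ln_enat m = (case m of enat k \<Rightarrow> if k = 0 then -\<infinity> else ereal (ln (real k)) | \<infinity> \<Rightarrow> \<infinity>)"

definition growth_rate :: "(nat \<Rightarrow> enat) \<Rightarrow> ereal" where
  "growth_rate p = limsup (\<lambda>n. ln_enat (p n) / ereal (real n))"

definition upper_mdim :: "'a set \<Rightarrow> ('a \<Rightarrow> 'a) \<Rightarrow> ('a \<Rightarrow> 'a \<Rightarrow> real) \<Rightarrow> ereal" where
  "upper_mdim X T d =
     Limsup (at_right 0) (\<lambda>\<delta>. ereal (1 / ln (1 / \<delta>)) *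
       growth_rate (\<lambda>n. span_num X T d n X \<delta>))"

definition upper_tail_mdim ::
  "real \<Rightarrow> 'a set \<Rightarrow> ('a \<Rightarrow> 'a) \<Rightarrow> ('a \<Rightarrow> 'a \<Rightarrow> real) \<Rightarrow> ereal" where
  "upper_tail_mdim \<epsilon> X T d =
     Limsup (at_right 0) (\<lambda>\<delta>. ereal (1 / ln (1 / \<delta>)) *
       growth_rate (\<lambda>n. SUP x\<in>X. span_num X T d n (bowen_ball X T d n x \<epsilon>) \<delta>))"

definition upper_pre_mdim ::
  "real \<Rightarrow> 'a set \<Rightarrow> ('a \<Rightarrow> 'a) \<Rightarrow> ('a \<Rightarrow> 'a \<Rightarrow> real) \<Rightarrow> ereal" where
  "upper_pre_mdim \<epsilon> X T d =
     Limsup (at_right 0) (\<lambda>\<delta>. ereal (1 / ln (1 / \<delta>)) *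
       growth_rate (\<lambda>n. SUP (x, k) \<in> X \<times> {n..}.
         span_num X T d n ((T ^^ k) -` Metric_space.mball X d x \<epsilon> \<inter> X) \<delta>))"

end

(* Cover X by N^n sets of the type entering the definition of the tail (resp. preimage)
   quantity, where N does not depend on \<delta>: for the tail quantity take Bowen balls of radius \<epsilon>
   centred at one point per itinerary through a finite \<epsilon>/2-net, for the preimage quantity take
   the preimages under T^n of the \<epsilon>-balls around an \<epsilon>-net. The \<delta>-growth rates therefore differ
   by at most ln N, and this constant is killed by the factor 1 / ln (1/\<delta>). *)
theory Submission
  imports Defs
begin

lemma ln_enat_mono: "a \<le> b \<Longrightarrow> ln_enat a \<le> ln_enat b"
  by (cases a; cases b) (auto simp: ln_enat_def)

lemma ln_enat_mult_enat:
  assumes "c > 0"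
  shows "ln_enat (enat c * m) = ereal (ln (real c)) + ln_enat m"
  using assms by (cases m) (auto simp: ln_enat_def ln_mult)

lemma growth_rate_mono:
  assumes "\<And>n. n > 0 \<Longrightarrow> p n \<le> q n"
  shows "growth_rate p \<le> growth_rate q"
  unfolding growth_rate_def
proof (rule Limsup_mono)
  show "\<forall>\<^sub>F n in sequentially. ln_enat (p n) / ereal (real n) \<le> ln_enat (q n) / ereal (real n)"
    using eventually_gt_at_top[of "0::nat"]
    by eventually_elim (intro ereal_divide_right_mono ln_enat_mono assms, auto)
qed

text \<open>The logarithm of \<open>N ^ n\<close> is \<open>n * ln N\<close>, so division by
  \<open>n\<close> leaves the constant \<open>ln N\<close>. Since \<open>N > 0\<close> makes this
  constant finite, adding it is harmless even where \<open>ln_enat (q n)\<close> is infinite, and it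
  can be pulled out of the \<open>limsup\<close>.\<close>

lemma growth_rate_power_mult:
  assumes "N > 0"
  shows "growth_rate (\<lambda>n. enat (N ^ n) * q n) = ereal (ln (real N)) + growth_rate q"
proof -
  have eq: "ln_enat (enat (N ^ n) * q n) / ereal (real n)
      = ereal (ln (real N)) + ln_enat (q n) / ereal (real n)" if "n > 0" for n
  proof -
    have "ln_enat (enat (N ^ n) * q n) = ereal (real n * ln (real N)) + ln_enat (q n)"
      using assms by (simp add: ln_enat_mult_enat ln_realpow)
    then show ?thesis
      using that by (cases "ln_enat (q n)") (auto simp: add_divide_distrib)
  qed
  have "growth_rate (\<lambda>n. enat (N ^ n) * q n)
      = limsup (\<lambda>n. ereal (ln (real N)) + ln_enat (q n) / ereal (real n))"
    unfolding growth_rate_def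
    by (intro Limsup_eq eventually_mono[OF eventually_gt_at_top[of 0]] eq)
  then show ?thesis
    by (simp add: growth_rate_def Limsup_add_ereal_left)
qed

text \<open>Near 0 one has 0 < \<open>\<delta>\<close> < 1, where the factor
  \<open>1 / ln (1 / \<delta>)\<close> is positive and multiplication by it preserves order. This
  gives the easy inequalities, with the whole space as upper bound.\<close>

lemma Limsup_growth_rate_mono:
  assumes "\<And>\<delta> n. n > 0 \<Longrightarrow> p \<delta> n \<le> q \<delta> n"
  shows "Limsup (at_right 0) (\<lambda>\<delta>. ereal (1 / ln (1 / \<delta>)) * growth_rate (p \<delta>))
       \<le> Limsup (at_right 0) (\<lambda>\<delta>. ereal (1 / ln (1 / \<delta>)) * growth_rate (q \<delta>))"
proof (rule Limsup_mono)
  have "\<forall>\<^sub>F \<delta>::real in at_right 0. 0 < \<delta> \<and> \<delta> < 1"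
    by (auto simp: eventually_at_right_field intro: exI[of _ 1])
  then show "\<forall>\<^sub>F \<delta> in at_right 0. ereal (1 / ln (1 / \<delta>)) * growth_rate (p \<delta>)
      \<le> ereal (1 / ln (1 / \<delta>)) * growth_rate (q \<delta>)"
    by eventually_elim (intro ereal_mult_left_mono growth_rate_mono assms, auto)
qed

text \<open>A factor \<open>N ^ n\<close> costs only the summand
  \<open>ln N / ln (1 / \<delta>)\<close>, which tends to 0 because \<open>N\<close> is the same for
  all \<open>\<delta>\<close>. It is thus eventually below any \<open>e > 0\<close>, and
  \<open>e\<close> is arbitrary. Both hard inequalities reduce to this.\<close>

lemma Limsup_growth_rate_le_of_power_mult:
  assumes N: "N > 0" and le: "\<And>\<delta> n. n > 0 \<Longrightarrow> p \<delta> n \<le> enat (N ^ n) * q \<delta> n"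
  shows "Limsup (at_right 0) (\<lambda>\<delta>. ereal (1 / ln (1 / \<delta>)) * growth_rate (p \<delta>))
       \<le> Limsup (at_right 0) (\<lambda>\<delta>. ereal (1 / ln (1 / \<delta>)) * growth_rate (q \<delta>))"
    (is "Limsup ?F ?P \<le> Limsup ?F ?Q")
proof (rule ereal_le_epsilon2)
  fix e :: real assume e: "e > 0"
  have "((\<lambda>\<delta>::real. 1 / ln (1 / \<delta>) * ln (real N)) \<longlongrightarrow> 0) ?F"
    using tendsto_divide_0[OF tendsto_const filterlim_at_top_imp_at_infinity[OF
        filterlim_compose[OF ln_at_top filterlim_inverse_at_top_right]], of "ln (real N)"]
    by (simp add: inverse_eq_divide)
  then have "\<forall>\<^sub>F \<delta> in ?F. 1 / ln (1 / \<delta>) * ln (real N) < e"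
    using e by (rule order_tendstoD)
  moreover have "\<forall>\<^sub>F \<delta>::real in ?F. 0 < \<delta> \<and> \<delta> < 1"
    by (auto simp: eventually_at_right_field intro: exI[of _ 1])
  ultimately have "\<forall>\<^sub>F \<delta> in ?F. ?P \<delta> \<le> ?Q \<delta> + ereal e"
  proof eventually_elim
    case (elim \<delta>)
    have "?P \<delta> \<le> ereal (1 / ln (1 / \<delta>)) * (ereal (ln (real N)) + growth_rate (q \<delta>))"
      unfolding growth_rate_power_mult[OF N, symmetric]
      using elim by (intro ereal_mult_left_mono growth_rate_mono le) auto
    also have "\<dots> = ereal (1 / ln (1 / \<delta>) * ln (real N)) + ?Q \<delta>"
      \<comment> \<open>Distributivity is safe in \<open>ereal\<close> here: the outer factor and
        \<open>ln N\<close> are finite, whatever the growth rate of \<open>q \<delta>\<close>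
        is.\<close>
      by (subst ereal_distrib_left) auto
    also have "\<dots> \<le> ereal e + ?Q \<delta>"
      using elim by (intro add_right_mono) auto
    finally show ?case by (simp add: add.commute)
  qed
  then have "Limsup ?F ?P \<le> Limsup ?F (\<lambda>\<delta>. ?Q \<delta> + ereal e)"
    by (rule Limsup_mono)
  then show "Limsup ?F ?P \<le> Limsup ?F ?Q + ereal e"
    by (simp add: Limsup_add_ereal_right)
qed

lemma bowen_dist_less_iff:
  "n > 0 \<Longrightarrow> bowen_dist T d n x y < e \<longleftrightarrow> (\<forall>j<n. d ((T ^^ j) x) ((T ^^ j) y) < e)"
  by (subst bowen_dist_def, subst Max_less_iff) auto

lemma span_num_mono: "Z \<subseteq> W \<Longrightarrow> span_num X T d n Z \<delta> \<le> span_num X T d n W \<delta>"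
  unfolding span_num_def by (rule INF_superset_mono) auto

lemma span_num_le:
  assumes "E \<subseteq> X" "finite E" "\<forall>x\<in>Z. \<exists>y\<in>E. bowen_dist T d n x y < \<delta>"
  shows "span_num X T d n Z \<delta> \<le> enat (card E)"
  unfolding span_num_def by (rule INF_lower) (use assms in auto)

text \<open>A finite value excludes the empty family, whose infimum is infinite; an infimum of a
  nonempty set in the well-ordered type \<open>enat\<close> is a minimum.\<close>

lemma span_num_attained:
  assumes "span_num X T d n Z \<delta> \<noteq> \<infinity>"
  obtains E where "E \<subseteq> X" "finite E" "\<forall>x\<in>Z. \<exists>y\<in>E. bowen_dist T d n x y < \<delta>"
    "span_num X T d n Z \<delta> = enat (card E)"
proof -
  let ?S = "{E. E \<subseteq> X \<and> finite E \<and> (\<forall>x\<in>Z. \<exists>y\<in>E. bowen_dist T d n x y < \<delta>)}"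
  let ?A = "(\<lambda>E. enat (card E)) ` ?S"
  have "?A \<noteq> {}"
    using assms unfolding span_num_def by (auto simp: Inf_enat_def split: if_splits)
  then have "Inf ?A \<in> ?A"
    by (metis (mono_tags, lifting) Inf_enat_def LeastI ex_in_conv)
  then show ?thesis
    using that unfolding span_num_def by auto
qed

text \<open>The union of optimal spanning sets for the two parts spans \<open>Z \<union> W\<close>;
  if either number is infinite, so is the right-hand side.\<close>

lemma span_num_Un:
  "span_num X T d n (Z \<union> W) \<delta> \<le> span_num X T d n Z \<delta> + span_num X T d n W \<delta>"
proof (cases "span_num X T d n Z \<delta> = \<infinity> \<or> span_num X T d n W \<delta> = \<infinity>")
  case False
  obtain E where E: "E \<subseteq> X" "finite E" "\<forall>x\<in>Z. \<exists>y\<in>E. bowen_dist T d n x y < \<delta>"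
    "span_num X T d n Z \<delta> = enat (card E)"
    using False span_num_attained by metis
  obtain D where D: "D \<subseteq> X" "finite D" "\<forall>x\<in>W. \<exists>y\<in>D. bowen_dist T d n x y < \<delta>"
    "span_num X T d n W \<delta> = enat (card D)"
    using False span_num_attained by metis
  have "span_num X T d n (Z \<union> W) \<delta> \<le> enat (card (E \<union> D))"
    by (rule span_num_le) (use E D in auto)
  also have "\<dots> \<le> enat (card E + card D)"
    by (simp add: card_Un_le)
  finally show ?thesis using E D by simp
qed auto

text \<open>Iterated subadditivity; this turns a cover of \<open>X\<close> by few sets into a bound
  on the spanning number of \<open>X\<close>.\<close>

lemma span_num_UN:
  assumes "finite I" "\<And>i. i \<in> I \<Longrightarrow> span_num X T d n (Z i) \<delta> \<le> m"
  shows "span_num X T d n (\<Union>i\<in>I. Z i) \<delta> \<le> enat (card I) * m"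
  using assms
proof (induction I rule: finite_induct)
  case empty
  \<comment> \<open>No points are needed to span the empty set, so the left-hand side is 0; this
    agrees with \<open>enat 0 * m\<close>, also for infinite \<open>m\<close>.\<close>
  show ?case using span_num_le[of "{}" X "{}" T d n \<delta>] by (simp flip: zero_enat_def)
next
  case (insert i I)
  have "span_num X T d n (\<Union>i\<in>insert i I. Z i) \<delta>
      \<le> span_num X T d n (Z i) \<delta> + span_num X T d n (\<Union>i\<in>I. Z i) \<delta>"
    using span_num_Un by simp
  also have "\<dots> \<le> m + enat (card I) * m"
    using insert by (intro add_mono) auto
  also have "\<dots> = enat (card (insert i I)) * m"
    using insert by (simp add: mult_eSuc flip: eSuc_enat)
  finally show ?case .
qed

context
  fixes X :: "'a set" and d :: "'a \<Rightarrow> 'a \<Rightarrow> real" and T :: "'a \<Rightarrow> 'a"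
  assumes TDS: "TDS X d T"
begin

interpretation Metric_space X d
  using TDS by (simp add: TDS_def)

lemma TDS_funpow_mem: "x \<in> X \<Longrightarrow> (T ^^ j) x \<in> X"
  using TDS continuous_map_image_subset_topspace[of mtopology mtopology T]
  by (induction j) (auto simp: TDS_def)

lemma TDS_finite_net:
  assumes "\<epsilon> > 0"
  obtains F where "finite F" "F \<subseteq> X" "\<And>x. x \<in> X \<Longrightarrow> \<exists>y\<in>F. d y x < \<epsilon>"
proof -
  have "mtotally_bounded X"
    using TDS by (simp add: TDS_def compact_space_eq_mcomplete_mtotally_bounded)
  then obtain F where "finite F" "F \<subseteq> X" "X \<subseteq> (\<Union>x\<in>F. mball x \<epsilon>)"
    using assms by (auto simp: mtotally_bounded_def)
  then show ?thesis using that[of F] by (force simp: subset_iff)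
qed

text \<open>Points whose first \<open>n\<close> iterates stay within \<open>\<epsilon> / 2\<close>
  of the same sequence of net points have Bowen distance below \<open>\<epsilon>\<close>, and there
  are at most \<open>card F ^ n\<close> such sequences. The witness \<open>Suc (card F)\<close>
  stays positive even when \<open>X\<close>, and hence \<open>F\<close>, is empty.\<close>

lemma TDS_bowen_cover:
  assumes "\<epsilon> > 0"
  shows "\<exists>N>0. \<forall>n>0. \<exists>E. finite E \<and> E \<subseteq> X \<and> card E \<le> N ^ n \<and>
    X \<subseteq> (\<Union>x\<in>E. bowen_ball X T d n x \<epsilon>)"
proof -
  obtain F where F: "finite F" "F \<subseteq> X" "\<And>x. x \<in> X \<Longrightarrow> \<exists>y\<in>F. d y x < \<epsilon> / 2"
    using TDS_finite_net[of "\<epsilon> / 2"] assms by auto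
  have "\<exists>E. finite E \<and> E \<subseteq> X \<and> card E \<le> Suc (card F) ^ n \<and> X \<subseteq> (\<Union>x\<in>E. bowen_ball X T d n x \<epsilon>)"
    if n: "n > 0" for n
  proof -
    \<comment> \<open>\<open>s\<close> is an itinerary through the net, \<open>S\<close> collects
      those realised by some orbit, and \<open>c\<close> chooses one such starting point for each.
      Taking extensional functions on \<open>{..<n}\<close> makes the itineraries countable by
      \<open>card_funcsetE\<close>.\<close>
    define follows where "follows s y \<longleftrightarrow> y \<in> X \<and> (\<forall>j<n. d (s j) ((T ^^ j) y) < \<epsilon> / 2)" for s y
    define S where "S = {s \<in> {..<n} \<rightarrow>\<^sub>E F. \<exists>y. follows s y}"
    define c where "c s = (SOME y. follows s y)" for s
    have c: "follows s (c s)" if "s \<in> S" for s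
      using that unfolding S_def c_def by (auto intro: someI)
    have fin: "finite ({..<n} \<rightarrow>\<^sub>E F)"
      using F by (simp add: finite_PiE)
    then have finS: "finite S" unfolding S_def by simp
    have "card (c ` S) \<le> card S"
      using finS by (rule card_image_le)
    also have "\<dots> \<le> card ({..<n} \<rightarrow>\<^sub>E F)"
      using fin by (intro card_mono) (auto simp: S_def)
    also have "\<dots> \<le> Suc (card F) ^ n"
      by (simp add: card_funcsetE power_mono)
    finally have card: "card (c ` S) \<le> Suc (card F) ^ n" .
    have "\<exists>x\<in>c ` S. y \<in> bowen_ball X T d n x \<epsilon>" if y: "y \<in> X" for y
    proof -
      obtain g where g: "\<And>x. x \<in> X \<Longrightarrow> g x \<in> F \<and> d (g x) x < \<epsilon> / 2"
        using F(3) by metis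
      \<comment> \<open>An itinerary of \<open>y\<close>: each iterate is replaced by a nearby net
        point. Both \<open>y\<close> and \<open>c s\<close> follow it, so the triangle inequality
        through \<open>s j\<close> compares their orbits.\<close>
      define s where "s = (\<lambda>j\<in>{..<n}. g ((T ^^ j) y))"
      have sy: "follows s y"
        using y g TDS_funpow_mem by (auto simp: follows_def s_def)
      moreover have sF: "s \<in> {..<n} \<rightarrow>\<^sub>E F"
        using y g TDS_funpow_mem by (auto simp: s_def)
      ultimately have s: "s \<in> S" by (auto simp: S_def)
      have "d ((T ^^ j) (c s)) ((T ^^ j) y) < \<epsilon>" if "j < n" for j
      proof -
        have "s j \<in> X" using sF F(2) that by auto
        then have "d ((T ^^ j) (c s)) ((T ^^ j) y) \<le> d (s j) ((T ^^ j) (c s)) + d (s j) ((T ^^ j) y)"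
          using c[OF s] y by (subst (2) commute) (intro triangle, auto simp: follows_def TDS_funpow_mem)
        also have "\<dots> < \<epsilon> / 2 + \<epsilon> / 2"
          using c[OF s] sy that unfolding follows_def by (intro add_strict_mono) auto
        finally show ?thesis by simp
      qed
      then have "y \<in> bowen_ball X T d n (c s) \<epsilon>"
        using y n by (simp add: bowen_ball_def bowen_dist_less_iff)
      then show ?thesis using s by auto
    qed
    then show ?thesis
      using card finS c by (intro exI[of _ "c ` S"]) (auto simp: follows_def)
  qed
  then show ?thesis by (intro exI[of _ "Suc (card F)"]) simp
qed

lemma upper_tail_mdim_eq_upper_mdim:
  assumes "\<epsilon> > 0"
  shows "upper_tail_mdim \<epsilon> X T d = upper_mdim X T d"
proof (rule antisym)
  show "upper_tail_mdim \<epsilon> X T d \<le> upper_mdim X T d"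
    unfolding upper_tail_mdim_def upper_mdim_def
    by (intro Limsup_growth_rate_mono SUP_least span_num_mono) (auto simp: bowen_ball_def)
  obtain N where N: "N > 0"
    "\<forall>n>0. \<exists>E. finite E \<and> E \<subseteq> X \<and> card E \<le> N ^ n \<and> X \<subseteq> (\<Union>x\<in>E. bowen_ball X T d n x \<epsilon>)"
    using TDS_bowen_cover[OF assms] by (elim exE conjE)
  show "upper_mdim X T d \<le> upper_tail_mdim \<epsilon> X T d"
    unfolding upper_tail_mdim_def upper_mdim_def
  proof (rule Limsup_growth_rate_le_of_power_mult[OF N(1)])
    fix \<delta> and n :: nat assume "n > 0"
    then obtain E where E: "finite E" "E \<subseteq> X" "card E \<le> N ^ n"
      "X \<subseteq> (\<Union>x\<in>E. bowen_ball X T d n x \<epsilon>)"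
      using N(2) by (elim allE[of _ n] impE exE conjE)
    \<comment> \<open>The centres in \<open>E\<close> lie in \<open>X\<close>, so this supremum
      bounds the spanning number of every ball of the cover.\<close>
    let ?m = "SUP x\<in>X. span_num X T d n (bowen_ball X T d n x \<epsilon>) \<delta>"
    have "span_num X T d n X \<delta> \<le> span_num X T d n (\<Union>x\<in>E. bowen_ball X T d n x \<epsilon>) \<delta>"
      using E(4) by (rule span_num_mono)
    also have "\<dots> \<le> enat (card E) * ?m"
      using E by (intro span_num_UN SUP_upper) auto
    also have "\<dots> \<le> enat (N ^ n) * ?m"
      using E by (intro mult_right_mono) auto
    finally show "span_num X T d n X \<delta> \<le> enat (N ^ n) * ?m" .
  qed
qed

text \<open>Here the number of covering sets, \<open>card F\<close>, does not even grow with
  \<open>n\<close>: one net of \<open>X\<close> is pulled back by \<open>T ^^ n\<close>.\<close>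

lemma upper_pre_mdim_eq_upper_mdim:
  assumes "\<epsilon> > 0"
  shows "upper_pre_mdim \<epsilon> X T d = upper_mdim X T d"
proof (rule antisym)
  show "upper_pre_mdim \<epsilon> X T d \<le> upper_mdim X T d"
    unfolding upper_pre_mdim_def upper_mdim_def
    by (intro Limsup_growth_rate_mono SUP_least) (auto intro!: span_num_mono)
  obtain F where F: "finite F" "F \<subseteq> X" "\<And>x. x \<in> X \<Longrightarrow> \<exists>y\<in>F. d y x < \<epsilon>"
    using TDS_finite_net[OF assms] by blast
  let ?N = "Suc (card F)"
  show "upper_mdim X T d \<le> upper_pre_mdim \<epsilon> X T d"
    unfolding upper_pre_mdim_def upper_mdim_def
  proof (rule Limsup_growth_rate_le_of_power_mult[of ?N])
    fix \<delta> and n :: nat assume n: "n > 0"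
    let ?Z = "\<lambda>x. (T ^^ n) -` mball x \<epsilon> \<inter> X"
    let ?m = "SUP (x, k) \<in> X \<times> {n..}. span_num X T d n ((T ^^ k) -` mball x \<epsilon> \<inter> X) \<delta>"
    \<comment> \<open>\<open>T ^^ n\<close> maps \<open>X\<close> into itself, so the image of each
      point lies in a ball around some net point.\<close>
    have "X \<subseteq> (\<Union>x\<in>F. ?Z x)"
      using F TDS_funpow_mem[of _ n] by (fastforce simp: subset_iff)
    then have "span_num X T d n X \<delta> \<le> span_num X T d n (\<Union>x\<in>F. ?Z x) \<delta>"
      by (rule span_num_mono)
    also have "\<dots> \<le> enat (card F) * ?m"
    proof (rule span_num_UN[OF F(1)])
      fix x assume "x \<in> F"
      then show "span_num X T d n (?Z x) \<delta> \<le> ?m"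
        using F(2) by (intro SUP_upper2[of "(x, n)"]) auto
    qed
    \<comment> \<open>A crude bound, valid since \<open>n > 0\<close>, that gives the constant
      number of sets the power form required by the comparison lemma.\<close>
    also have "card F \<le> ?N ^ n"
      using n self_le_power[of ?N n] by simp
    then have "enat (card F) * ?m \<le> enat (?N ^ n) * ?m"
      by (intro mult_right_mono) auto
    finally show "span_num X T d n X \<delta> \<le> enat (?N ^ n) * ?m" .
  qed simp
qed

end

theorem theorem5p2:
  fixes X :: "'a set" and d :: "'a \<Rightarrow> 'a \<Rightarrow> real" and T :: "'a \<Rightarrow> 'a" and \<epsilon> :: real
  assumes "TDS X d T" and "\<epsilon> > 0"
  shows "upper_tail_mdim \<epsilon> X T d = upper_pre_mdim \<epsilon> X T d \<and>
         upper_pre_mdim \<epsilon> X T d = upper_mdim X T d"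
  using upper_tail_mdim_eq_upper_mdim[OF assms] upper_pre_mdim_eq_upper_mdim[OF assms] by simp

end
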